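(* Let $m_1=p_1^{e_1}\cdots p_r^{e_r}$ be a product of powers of $r>1$ distinct odd primes and $m_2=q_1^{c_1}\cdots q_\ell^{c_\ell}$ a product of powers of $\ell>1$ distinct odd primes, with $\gcd(m_1,m_2)=1$, and let $m=m_1m_2$. Let $t_1,t_2,t$ be the multiplicative orders of $2$ modulo $m_1,m_2,m$ respectively, so that $\mathbf{F}_{2^{t_1}}$ and $\mathbf{F}_{2^{t_2}}$ are subfields of $\mathbf{F}_{2^t}$. Let $\gamma\in\mathbf{F}_{2^t}$ have order $m$, $\gamma_1\in\mathbf{F}_{2^{t_1}}$ have order $m_1$ and $\gamma_2\in\mathbf{F}_{2^{t_2}}$ have order $m_2$. Suppose $P_1(x)\in\mathbf{F}_{2^{t_1}}[x]$ is an $S_{m_1}$-decoding polynomial with respect to $\gamma_1$ having $k_1$ monomials, and $P_2(x)\in\mathbf{F}_{2^{t_2}}[x]$ is an $S_{m_2}$-decoding polynomial with respect to $\gamma_2$ having $k_2$ monomials. Then there is an $S_m$-decoding polynomial $P(x)\in\mathbf{F}_{2^t}[x]$ with respect to $\gamma$ having $k\le k_1k_2$ monomials; consequently, for all integers $n,h\ge1$ and every family of $S_m$-matching vectors $\vec u_1,\dots,\vec u_n\in\mathbf{Z}_m^h$, the code $C:\mathbf{F}_{2^t}^n\to\mathbf{F}_{2^t}^N$, $N=m^h$, built from $\gamma$, $P$ and $\vec u_1,\dots,\vec u_n$ is a $k$-query locally decodable code: its decoders $D_i$ make $k$ queries and satisfy $D_i(C(\vec x))=x_i$ with probability $1$ for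 every $\vec x\in\mathbf{F}_{2^t}^n$ and every $i\in[1,n]$.
   Context: For $m=\prod_i p_i^{e_i}$ (distinct primes $p_i$, $e_i\ge1$), the canonical set is $S_m=\{s\in\mathbf{Z}_m\setminus\{0\}:\ \text{for each } i,\ s\equiv 0 \text{ or } s\equiv 1 \pmod{p_i^{e_i}}\}$. For $\vec x,\vec y\in\mathbf{Z}_m^h$, $\langle\vec x,\vec y\rangle_m=\sum_j x_jy_j \bmod m$. Vectors $\vec u_1,\dots,\vec u_n\in\mathbf{Z}_m^h$ are $S$-matching if $\langle\vec u_i,\vec u_i\rangle_m=0$ for all $i$ and $\langle\vec u_i,\vec u_j\rangle_m\in S$ for all $i\ne j$. For $\gamma$ of order $m$ in a field, a polynomial $P$ is an $S$-decoding polynomial (with respect to $\gamma$) if $P(\gamma^s)=0$ for all $s\in S$ and $P(1)=1$. Construction: write $P(x)=\sum_{j=0}^{k-1}a_jx^{b_j}$ with distinct exponents $b_j$. Coordinates of $\mathbf{F}_{2^t}^N$ are indexed by $\vec z\in\mathbf{Z}_m^h$; $C(\vec x)=\sum_{i=1}^n x_iC(\vec e_i)$ with $C(\vec e_i)=(\gamma^{\langle\vec u_i,\vec z\rangle_m})_{\vec z\in\mathbf{Z}_m^h}$. Decoder $D_i$ on input $\vec y$: choose $\vec v\in\mathbf{Z}_m^h$ uniformly, query $\vec y(\vec v+b_j\vec u_i)$ for $j=0,\dots,k-1$, output $\gamma^{-\langle\vec u_i,\vec v\rangle_m}\sum_{j}a_j\vec y(\vec v+b_j\vec u_i)$. *)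

theory Defs
  imports
    "HOL-Number_Theory.Number_Theory"
    "HOL-Probability.Probability"
    "HOL-Computational_Algebra.Polynomial"
begin

definition is_subfield :: "'a::field set \<Rightarrow> bool" where
  "is_subfield K \<longleftrightarrow> 0 \<in> K \<and> 1 \<in> K \<and>
     (\<forall>x\<in>K. \<forall>y\<in>K. x + y \<in> K \<and> x * y \<in> K) \<and>
     (\<forall>x\<in>K. - x \<in> K \<and> inverse x \<in> K)"

definition has_mult_order :: "'a::field \<Rightarrow> nat \<Rightarrow> bool" where
  "has_mult_order g m \<longleftrightarrow> m > 0 \<and> g ^ m = 1 \<and> (\<forall>k. 0 < k \<and> k < m \<longrightarrow> g ^ k \<noteq> 1)"

text \<open>The ring of integers modulo m is represented by its least residues
  \<open>{..<m}\<close>, and vectors of length h over it by extensional functions on \<open>{1..h}\<close>.\<close>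

definition canonical_set :: "nat \<Rightarrow> nat set" where
  "canonical_set m = {s. s < m \<and> s \<noteq> 0 \<and>
     (\<forall>p\<in>prime_factors m.
        [s = 0] (mod p ^ multiplicity p m) \<or> [s = 1] (mod p ^ multiplicity p m))}"

definition Zvec :: "nat \<Rightarrow> nat \<Rightarrow> (nat \<Rightarrow> nat) set" where
  "Zvec m h = {1..h} \<rightarrow>\<^sub>E {..<m}"

definition inner_mod :: "nat \<Rightarrow> nat \<Rightarrow> (nat \<Rightarrow> nat) \<Rightarrow> (nat \<Rightarrow> nat) \<Rightarrow> nat" where
  "inner_mod m h x y = (\<Sum>j=1..h. x j * y j) mod m"

definition add_scaled_mod :: "nat \<Rightarrow> nat \<Rightarrow> (nat \<Rightarrow> nat) \<Rightarrow> nat \<Rightarrow> (nat \<Rightarrow> nat) \<Rightarrow> (nat \<Rightarrow> nat)" where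
  "add_scaled_mod m h v b w = (\<lambda>j\<in>{1..h}. (v j + b * w j) mod m)"

definition matching_vectors ::
    "nat set \<Rightarrow> nat \<Rightarrow> nat \<Rightarrow> nat \<Rightarrow> (nat \<Rightarrow> nat \<Rightarrow> nat) \<Rightarrow> bool" where
  "matching_vectors S m h n u \<longleftrightarrow>
     (\<forall>i\<in>{1..n}. u i \<in> Zvec m h) \<and>
     (\<forall>i\<in>{1..n}. inner_mod m h (u i) (u i) = 0) \<and>
     (\<forall>i\<in>{1..n}. \<forall>j\<in>{1..n}. i \<noteq> j \<longrightarrow> inner_mod m h (u i) (u j) \<in> S)"

definition decoding_polynomial :: "nat set \<Rightarrow> 'a::field \<Rightarrow> 'a poly \<Rightarrow> bool" where
  "decoding_polynomial S g P \<longleftrightarrow> (\<forall>s\<in>S. poly P (g ^ s) = 0) \<and> poly P 1 = 1"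

text \<open>The exponents \<open>b\<^sub>0, \<dots>, b\<^bsub>k-1\<^esub>\<close> of the monomials occurring in P; the
  corresponding coefficients are \<open>coeff P b\<^sub>j\<close>.\<close>

definition exponents :: "'a::zero poly \<Rightarrow> nat list" where
  "exponents P = sorted_list_of_set {b. coeff P b \<noteq> 0}"

definition num_monomials :: "'a::zero poly \<Rightarrow> nat" where
  "num_monomials P = card {b. coeff P b \<noteq> 0}"

text \<open>A (non-adaptive) randomized decoder draws a list of positions to query together
  with a function computing its output from the list of answers; its output therefore
  depends on the received word only through the answers to its queries.\<close>

type_synonym ('c, 'a) decoder = "('c list \<times> ('a list \<Rightarrow> 'a)) pmf"

definition run_decoder :: "('c, 'a) decoder \<Rightarrow> ('c \<Rightarrow> 'a) \<Rightarrow> 'a pmf" where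
  "run_decoder D y = map_pmf (\<lambda>(qs, f). f (map y qs)) D"

definition makes_queries :: "nat \<Rightarrow> 'c set \<Rightarrow> ('c, 'a) decoder \<Rightarrow> bool" where
  "makes_queries k Z D \<longleftrightarrow> (\<forall>(qs, f)\<in>set_pmf D. length qs = k \<and> set qs \<subseteq> Z)"

text \<open>Messages are indexed by I, codeword coordinates by Z. Decodability means perfect
  recovery from uncorrupted codewords by k-query decoders; no tolerance to corruptions
  is part of this notion.\<close>

definition locally_decodable ::
    "nat \<Rightarrow> 'i set \<Rightarrow> 'c set \<Rightarrow> (('i \<Rightarrow> 'a) \<Rightarrow> 'c \<Rightarrow> 'a) \<Rightarrow> ('i \<Rightarrow> ('c, 'a) decoder) \<Rightarrow> bool" where
  "locally_decodable k I Z C D \<longleftrightarrow>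
     C \<in> (I \<rightarrow>\<^sub>E UNIV) \<rightarrow> (Z \<rightarrow>\<^sub>E UNIV) \<and>
     (\<forall>i\<in>I. makes_queries k Z (D i) \<and>
        (\<forall>x\<in>I \<rightarrow>\<^sub>E UNIV. measure_pmf.prob (run_decoder (D i) (C x)) {x i} = 1))"

definition basis_codeword ::
    "nat \<Rightarrow> nat \<Rightarrow> 'a::field \<Rightarrow> (nat \<Rightarrow> nat) \<Rightarrow> (nat \<Rightarrow> nat) \<Rightarrow> 'a" where
  "basis_codeword m h g w = (\<lambda>z\<in>Zvec m h. g ^ inner_mod m h w z)"

definition mv_code ::
    "nat \<Rightarrow> nat \<Rightarrow> nat \<Rightarrow> 'a::field \<Rightarrow> (nat \<Rightarrow> nat \<Rightarrow> nat) \<Rightarrow> (nat \<Rightarrow> 'a) \<Rightarrow> (nat \<Rightarrow> nat) \<Rightarrow> 'a" where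
  "mv_code m h n g u x =
     (\<lambda>z\<in>Zvec m h. \<Sum>i=1..n. x i * basis_codeword m h g (u i) z)"

definition mv_decoder ::
    "nat \<Rightarrow> nat \<Rightarrow> 'a::field \<Rightarrow> 'a poly \<Rightarrow> (nat \<Rightarrow> nat \<Rightarrow> nat) \<Rightarrow> nat \<Rightarrow> (nat \<Rightarrow> nat, 'a) decoder" where
  "mv_decoder m h g P u i =
     map_pmf (\<lambda>v. (map (\<lambda>b. add_scaled_mod m h v b (u i)) (exponents P),
                   \<lambda>ans. g powi (- int (inner_mod m h (u i) v)) *
                          (\<Sum>j<length (exponents P). coeff P (exponents P ! j) * ans ! j)))
             (pmf_of_set (Zvec m h))"

end

theory Submission
  imports Defs
begin

text \<open>Since \<open>\<gamma>\<close> generates the group of all m-th roots of unity, \<open>\<gamma>\<^sub>1 = \<gamma> ^ \<alpha>\<close> and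
  \<open>\<gamma>\<^sub>2 = \<gamma> ^ \<beta>\<close>. The polynomial \<open>P(x) = P\<^sub>1(x ^ \<alpha>) P\<^sub>2(x ^ \<beta>)\<close> takes the value
  \<open>P\<^sub>1(\<gamma>\<^sub>1 ^ s) P\<^sub>2(\<gamma>\<^sub>2 ^ s)\<close> at \<open>\<gamma> ^ s\<close>. For a canonical s modulo m, each of \<open>s mod m\<^sub>1\<close> and
  \<open>s mod m\<^sub>2\<close> is zero or canonical, and they are not both zero, so one factor vanishes.
  Decoding works because restricting the codeword to the line \<open>v + b u\<^sub>i\<close> multiplies the
  contribution of \<open>x\<^sub>j\<close> by \<open>P(\<gamma> ^ \<langle>u\<^sub>j, u\<^sub>i\<rangle>)\<close> when summed against the coefficients of P.\<close>

section \<open>Powers of an element of multiplicative order \<open>m\<close>\<close>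

lemma has_mult_order_nonzero:
  assumes "has_mult_order g m"
  shows "g \<noteq> 0"
  using assms unfolding has_mult_order_def by (metis power_0_left zero_neq_one less_irrefl)

lemma has_mult_order_power_mod:
  assumes "has_mult_order g m"
  shows "g ^ (n mod m) = g ^ n"
proof -
  have "g ^ n = g ^ (m * (n div m) + n mod m)" by simp
  also have "\<dots> = g ^ (n mod m)"
    using assms unfolding power_add power_mult has_mult_order_def by simp
  finally show ?thesis ..
qed

lemma has_mult_order_inj_on:
  assumes "has_mult_order g m"
  shows "inj_on (\<lambda>i. g ^ i) {..<m}"
proof (rule linorder_inj_onI)
  fix i j assume ij: "i < j" "i \<in> {..<m}" "j \<in> {..<m}"
  have "g ^ j = g ^ i * g ^ (j - i)" using ij by (simp flip: power_add)
  moreover have "g ^ (j - i) \<noteq> 1"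
    using ij assms unfolding has_mult_order_def by auto
  moreover have "g ^ i \<noteq> 0" using has_mult_order_nonzero[OF assms] by simp
  ultimately show "g ^ i \<noteq> g ^ j" by auto
qed auto

text \<open>The \<open>m\<close> distinct powers \<open>g ^ i\<close> with \<open>i < m\<close> are
  roots of \<open>monom 1 m - 1\<close>, and a nonzero polynomial of degree at most \<open>m\<close>
  over a field has at most \<open>m\<close> roots, so these powers exhaust them.\<close>

lemma root_of_unity_eq_power:
  fixes g x :: "'a::field"
  assumes g: "has_mult_order g m" and x: "x ^ m = 1"
  obtains i where "x = g ^ i"
proof -
  let ?q = "monom 1 m - 1 :: 'a poly" and ?R = "(\<lambda>i. g ^ i) ` {..<m}"
  have "m > 0" using g by (simp add: has_mult_order_def)
  \<comment> \<open>For \<open>m = 0\<close> the polynomial \<open>?q\<close> would vanish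
    identically and the root bound would not apply.\<close>
  then have "coeff ?q m = 1" by (cases m) auto
  then have q: "?q \<noteq> 0" by (metis coeff_0 zero_neq_one)
  have "degree ?q \<le> m"
    by (intro degree_diff_le) (auto simp: degree_monom_le)
  then have card_le: "card {y. poly ?q y = 0} \<le> m"
    using card_poly_roots_bound[OF q] by linarith
  have roots: "{y. poly ?q y = 0} = {y. y ^ m = 1}" by (auto simp: poly_monom)
  have "?R \<subseteq> {y. y ^ m = 1}"
  proof clarify
    fix i
    show "(g ^ i) ^ m = 1"
      using g unfolding has_mult_order_def
      by (metis power_commutes power_mult mult.commute power_one)
  qed
  moreover have "card ?R = m" by (simp add: card_image has_mult_order_inj_on[OF g])
  moreover have "finite {y::'a. y ^ m = 1}" using poly_roots_finite[OF q] unfolding roots .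
  ultimately have "?R = {y. y ^ m = 1}"
    using card_le roots by (intro card_seteq) auto
  then have "x \<in> ?R" using x by simp
  then show thesis using that by auto
qed

section \<open>Polynomials as sums over their monomials\<close>

lemma finite_coeff_support: "finite {b. coeff P b \<noteq> 0}"
  by (rule finite_subset[of _ "{..degree P}"]) (auto intro: le_degree)

lemma poly_eq_sum_support:
  fixes P :: "'a::comm_semiring_1 poly"
  shows "poly P x = (\<Sum>b | coeff P b \<noteq> 0. coeff P b * x ^ b)"
  unfolding poly_altdef
  by (rule sum.mono_neutral_right) (auto intro: le_degree)

lemma sum_exponents:
  fixes P :: "'a::zero poly"
  shows "(\<Sum>j<length (exponents P). f (exponents P ! j)) = (\<Sum>b | coeff P b \<noteq> 0. f b)"
proof -
  have "(\<Sum>j<length (exponents P). f (exponents P ! j)) = sum_list (map f (exponents P))"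
    by (simp add: sum_list_sum_nth atLeast0LessThan)
  also have "\<dots> = sum f (set (exponents P))"
    by (rule sum_list_distinct_conv_sum_set) (simp add: exponents_def)
  finally show ?thesis by (simp add: exponents_def finite_coeff_support)
qed

text \<open>Expanding the product of the two sums gives one term for each pair of monomials of
  \<open>P\<close> and \<open>Q\<close>.\<close>

lemma exists_poly_mult_powers:
  fixes P Q :: "'a::comm_semiring_1 poly"
  obtains R where "\<And>x. poly R x = poly P (x ^ \<alpha>) * poly Q (x ^ \<beta>)"
    and "num_monomials R \<le> num_monomials P * num_monomials Q"
proof
  let ?A = "{b. coeff P b \<noteq> 0} \<times> {b. coeff Q b \<noteq> 0}"
  let ?R = "\<Sum>(a, b)\<in>?A. monom (coeff P a * coeff Q b) (\<alpha> * a + \<beta> * b)"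
  show "poly ?R x = poly P (x ^ \<alpha>) * poly Q (x ^ \<beta>)" for x
    unfolding poly_eq_sum_support[of P] poly_eq_sum_support[of Q]
    by (simp add: poly_sum poly_monom sum_product sum.cartesian_product case_prod_unfold
        power_add power_mult mult_ac)
  have fin: "finite ?A" by (simp add: finite_coeff_support)
  \<comment> \<open>Different pairs may share an exponent, and their terms may then merge or cancel.
    Hence only an inclusion, which suffices for the upper bound.\<close>
  have "{n. coeff ?R n \<noteq> 0} \<subseteq> (\<lambda>(a, b). \<alpha> * a + \<beta> * b) ` ?A"
  proof
    fix n assume "n \<in> {n. coeff ?R n \<noteq> 0}"
    then have "(\<Sum>x\<in>?A. coeff (case x of (a, b) \<Rightarrow>
        monom (coeff P a * coeff Q b) (\<alpha> * a + \<beta> * b)) n) \<noteq> 0"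
      by (simp add: coeff_sum)
    then obtain x where "x \<in> ?A" "coeff (case x of (a, b) \<Rightarrow>
        monom (coeff P a * coeff Q b) (\<alpha> * a + \<beta> * b)) n \<noteq> 0"
      by (rule sum.not_neutral_contains_not_neutral)
    then show "n \<in> (\<lambda>(a, b). \<alpha> * a + \<beta> * b) ` ?A"
      by (intro image_eqI[of _ _ x]) (auto split: if_splits)
  qed
  then have "card {n. coeff ?R n \<noteq> 0} \<le> card ?A"
    using fin by (rule surj_card_le[rotated])
  then show "num_monomials ?R \<le> num_monomials P * num_monomials Q"
    by (simp add: num_monomials_def card_cartesian_product)
qed

text \<open>By coprimality, a prime divisor of \<open>m\<close> occurs in \<open>m * n\<close> to
  the same power as in \<open>m\<close>. Reduction modulo \<open>m\<close> does not change residues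
  modulo that power.\<close>

lemma canonical_set_mod:
  assumes s: "s \<in> canonical_set (m * n)" and cop: "coprime m n"
    and nz: "s mod m \<noteq> 0"
  shows "s mod m \<in> canonical_set m"
proof -
  have "s < m * n" using s by (simp add: canonical_set_def)
  then have pos: "m > 0" "n > 0" by (auto intro: gr0I)
  have "[s mod m = 0] (mod p ^ multiplicity p m) \<or> [s mod m = 1] (mod p ^ multiplicity p m)"
    if p: "p \<in> prime_factors m" for p
  proof -
    have pr: "prime p" "p dvd m" using p by auto
    then have "\<not> p dvd n"
      using cop by (metis coprime_common_divisor not_prime_unit)
    then have mult: "multiplicity p (m * n) = multiplicity p m"
      using pr pos by (simp add: prime_elem_multiplicity_mult_distrib not_dvd_imp_multiplicity_0)
    have "p \<in> prime_factors (m * n)" using p pos by (simp add: prime_factors_product)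
    then have "[s = 0] (mod p ^ multiplicity p m) \<or> [s = 1] (mod p ^ multiplicity p m)"
      using s mult unfolding canonical_set_def by auto
    moreover have "[s mod m = s] (mod p ^ multiplicity p m)"
      unfolding unique_euclidean_semiring_class.cong_def by (rule mod_mod_cancel) (rule multiplicity_dvd)
    ultimately show ?thesis by (meson cong_trans)
  qed
  then show ?thesis using nz pos by (simp add: canonical_set_def)
qed

lemma decoding_polynomial_mod:
  assumes s: "s \<in> canonical_set (m * n)" and cop: "coprime m n"
    and g: "has_mult_order g m" and P: "decoding_polynomial (canonical_set m) g P"
    and nz: "s mod m \<noteq> 0"
  shows "poly P (g ^ s) = 0"
  using P canonical_set_mod[OF s cop nz] has_mult_order_power_mod[OF g, of s]
  unfolding decoding_polynomial_def by metis

lemma decoding_polynomial_product: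
  fixes g g1 g2 :: "'a::field"
  assumes g: "has_mult_order g (m1 * m2)" and cop: "coprime m1 m2"
    and g1: "has_mult_order g1 m1" and g2: "has_mult_order g2 m2"
    and P1: "decoding_polynomial (canonical_set m1) g1 P1"
    and P2: "decoding_polynomial (canonical_set m2) g2 P2"
  obtains P where "decoding_polynomial (canonical_set (m1 * m2)) g P"
    and "num_monomials P \<le> num_monomials P1 * num_monomials P2"
proof -
  have "g1 ^ (m1 * m2) = 1" "g2 ^ (m2 * m1) = 1"
    using g1 g2 unfolding power_mult has_mult_order_def by simp_all
  then obtain \<alpha> \<beta> where pow: "g1 = g ^ \<alpha>" "g2 = g ^ \<beta>"
    using root_of_unity_eq_power[OF g] by (metis mult.commute)
  obtain P where P: "\<And>x. poly P x = poly P1 (x ^ \<alpha>) * poly P2 (x ^ \<beta>)"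
    and num: "num_monomials P \<le> num_monomials P1 * num_monomials P2"
    using exists_poly_mult_powers[of P1 \<alpha> P2 \<beta>] by metis
  have "poly P (g ^ s) = 0" if s: "s \<in> canonical_set (m1 * m2)" for s
  proof -
    \<comment> \<open>If both residues were zero, coprimality would make \<open>m1 * m2\<close>
      divide \<open>s\<close>, although \<open>0 < s < m1 * m2\<close>.\<close>
    have "s mod m1 \<noteq> 0 \<or> s mod m2 \<noteq> 0"
    proof (rule ccontr)
      assume "\<not> ?thesis"
      then have "m1 * m2 dvd s" using cop by (simp add: divides_mult mod_eq_0_iff_dvd)
      then show False using s by (auto simp: canonical_set_def dest: dvd_imp_le)
    qed
    then have "poly P1 (g1 ^ s) = 0 \<or> poly P2 (g2 ^ s) = 0"
      using decoding_polynomial_mod[OF s cop g1 P1]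
        decoding_polynomial_mod[of s m2 m1, OF _ _ g2 P2] s cop
      by (auto simp: mult.commute coprime_commute)
    moreover have "poly P (g ^ s) = poly P1 (g1 ^ s) * poly P2 (g2 ^ s)"
      by (simp add: P pow flip: power_mult) (simp add: mult.commute)
    ultimately show ?thesis by auto
  qed
  moreover have "poly P 1 = 1"
    using P1 P2 by (simp add: P decoding_polynomial_def)
  ultimately show thesis using that num by (auto simp: decoding_polynomial_def)
qed

section \<open>The matching vector code and its decoder\<close>

lemma card_Zvec: "card (Zvec m h) = m ^ h"
  by (simp add: Zvec_def card_PiE)

lemma add_scaled_mod_in_Zvec: "m > 0 \<Longrightarrow> add_scaled_mod m h v b w \<in> Zvec m h"
  by (auto simp: Zvec_def add_scaled_mod_def)

text \<open>Linearity of the inner product in its second argument, moved into the exponent;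
  reductions modulo \<open>m\<close> are harmless because \<open>g ^ m = 1\<close>.\<close>

lemma power_inner_add_scaled:
  assumes g: "has_mult_order g m"
  shows "g ^ inner_mod m h x (add_scaled_mod m h v b w)
       = g ^ inner_mod m h x v * (g ^ inner_mod m h x w) ^ b"
proof -
  have "[(\<Sum>j=1..h. x j * add_scaled_mod m h v b w j) = (\<Sum>j=1..h. x j * (v j + b * w j))] (mod m)"
    by (intro cong_sum cong_mult) (simp_all add: add_scaled_mod_def unique_euclidean_semiring_class.cong_def)
  also have "(\<Sum>j=1..h. x j * (v j + b * w j)) = (\<Sum>j=1..h. x j * v j) + (\<Sum>j=1..h. x j * w j) * b"
    unfolding sum_distrib_right by (simp add: distrib_left sum.distrib mult_ac)
  finally show ?thesis
    unfolding inner_mod_def unique_euclidean_semiring_class.cong_def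
    by (simp add: has_mult_order_power_mod[OF g] power_add flip: power_mult)
qed

text \<open>This is the sum formed by the decoder: it yields \<open>x i\<close> up to a power of
  \<open>g\<close> that depends only on \<open>v\<close> and \<open>u i\<close>, which the decoder
  can divide out.\<close>

lemma mv_code_line:
  assumes g: "has_mult_order g m" and P: "decoding_polynomial S g P"
    and u: "matching_vectors S m h n u" and i: "i \<in> {1..n}"
  shows "(\<Sum>b | coeff P b \<noteq> 0. coeff P b * mv_code m h n g u x (add_scaled_mod m h v b (u i)))
       = x i * g ^ inner_mod m h (u i) v"
proof -
  let ?B = "{b. coeff P b \<noteq> 0}" and ?s = "\<lambda>l. inner_mod m h (u l) (u i)"
  have m: "m > 0" using g by (simp add: has_mult_order_def)
  have code: "mv_code m h n g u x (add_scaled_mod m h v b (u i))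
      = (\<Sum>l=1..n. x l * (g ^ inner_mod m h (u l) v * (g ^ ?s l) ^ b))" for b
    using add_scaled_mod_in_Zvec[OF m]
    by (simp add: mv_code_def basis_codeword_def power_inner_add_scaled[OF g])
  have "(\<Sum>b\<in>?B. coeff P b * mv_code m h n g u x (add_scaled_mod m h v b (u i)))
      = (\<Sum>l=1..n. \<Sum>b\<in>?B. coeff P b * (x l * (g ^ inner_mod m h (u l) v * (g ^ ?s l) ^ b)))"
    unfolding code sum_distrib_left by (rule sum.swap)
  also have "\<dots> = (\<Sum>l=1..n. x l * g ^ inner_mod m h (u l) v * poly P (g ^ ?s l))"
    unfolding poly_eq_sum_support by (simp add: sum_distrib_left mult_ac)
  \<comment> \<open>For \<open>l \<noteq> i\<close> the exponent \<open>?s l\<close> lies in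
    \<open>S\<close>, so the value of \<open>P\<close> is 0. For \<open>l = i\<close> the exponent
    is 0, and \<open>poly P 1 = 1\<close>.\<close>
  also have "\<dots> = (\<Sum>l=1..n. if l = i then x i * g ^ inner_mod m h (u i) v else 0)"
    using P u i unfolding decoding_polynomial_def matching_vectors_def
    by (intro sum.cong) auto
  also have "\<dots> = x i * g ^ inner_mod m h (u i) v" using i by simp
  finally show ?thesis .
qed

text \<open>The output equals \<open>x i\<close> for each fixed choice of \<open>v\<close>, so the
  randomness of the queries leaves a point mass.\<close>

lemma run_mv_decoder:
  assumes g: "has_mult_order g m" and P: "decoding_polynomial S g P"
    and u: "matching_vectors S m h n u" and i: "i \<in> {1..n}"
  shows "run_decoder (mv_decoder m h g P u i) (mv_code m h n g u x) = return_pmf (x i)"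
proof -
  have "g powi (- int (inner_mod m h (u i) v)) *
      (\<Sum>j<length (exponents P). coeff P (exponents P ! j) *
        map (mv_code m h n g u x) (map (\<lambda>b. add_scaled_mod m h v b (u i)) (exponents P)) ! j) = x i"
    (is "_ * ?sum = _") for v
  proof -
    have "?sum = (\<Sum>j<length (exponents P). coeff P (exponents P ! j) *
        mv_code m h n g u x (add_scaled_mod m h v (exponents P ! j) (u i)))"
      by simp
    also have "\<dots> = x i * g ^ inner_mod m h (u i) v"
      using sum_exponents[of "\<lambda>b. coeff P b * mv_code m h n g u x (add_scaled_mod m h v b (u i))" P]
        mv_code_line[OF g P u i] by simp
    finally show ?thesis
      using has_mult_order_nonzero[OF g] by (simp add: power_int_minus)
  qed
  then show ?thesis
    by (simp add: run_decoder_def mv_decoder_def pmf.map_comp o_def map_pmf_const del: map_map)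
qed

text \<open>The list \<open>exponents P\<close> has one entry for each monomial, which gives the
  query count. Success with probability 1 comes from the point mass at \<open>x i\<close>.\<close>

lemma mv_code_locally_decodable:
  assumes g: "has_mult_order g m" and P: "decoding_polynomial S g P"
    and u: "matching_vectors S m h n u"
  shows "locally_decodable (num_monomials P) {1..n} (Zvec m h)
    (mv_code m h n g u) (mv_decoder m h g P u)"
proof -
  have m: "m > 0" using g by (simp add: has_mult_order_def)
  have "makes_queries (num_monomials P) (Zvec m h) (mv_decoder m h g P u i)" for i
    using add_scaled_mod_in_Zvec[OF m]
    by (auto simp: makes_queries_def mv_decoder_def exponents_def num_monomials_def
        finite_coeff_support)
  then show ?thesis
    unfolding locally_decodable_def using run_mv_decoder[OF g P u]
    by (auto simp: mv_code_def[abs_def] simp del: One_nat_def)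
qed

theorem theorem4p8:
  fixes r l m1 m2 m t1 t2 t k1 k2 :: nat
    and p e q c :: "nat \<Rightarrow> nat"
    and K1 K2 :: "'a::{field,finite} set"
    and g g1 g2 :: 'a
    and P1 P2 :: "'a poly"
  assumes "r > 1"
    and "\<forall>i<r. prime (p i) \<and> odd (p i) \<and> e i \<ge> 1"
    and "inj_on p {..<r}"
    and "m1 = (\<Prod>i<r. p i ^ e i)"
    and "l > 1"
    and "\<forall>i<l. prime (q i) \<and> odd (q i) \<and> c i \<ge> 1"
    and "inj_on q {..<l}"
    and "m2 = (\<Prod>i<l. q i ^ c i)"
    and "coprime m1 m2"
    and "m = m1 * m2"
    and "t1 = ord m1 2" and "t2 = ord m2 2" and "t = ord m 2"
    and "CARD('a) = 2 ^ t"
    and "is_subfield K1" and "card K1 = 2 ^ t1"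
    and "is_subfield K2" and "card K2 = 2 ^ t2"
    and "has_mult_order g m"
    and "g1 \<in> K1" and "has_mult_order g1 m1"
    and "g2 \<in> K2" and "has_mult_order g2 m2"
    and "set (coeffs P1) \<subseteq> K1"
    and "decoding_polynomial (canonical_set m1) g1 P1"
    and "num_monomials P1 = k1"
    and "set (coeffs P2) \<subseteq> K2"
    and "decoding_polynomial (canonical_set m2) g2 P2"
    and "num_monomials P2 = k2"
  shows "\<exists>(P :: 'a poly) k.
           decoding_polynomial (canonical_set m) g P \<and>
           num_monomials P = k \<and> k \<le> k1 * k2 \<and>
           (\<forall>n h u. n \<ge> 1 \<longrightarrow> h \<ge> 1 \<longrightarrow> matching_vectors (canonical_set m) m h n u \<longrightarrow>
              card (Zvec m h) = m ^ h \<and>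
              locally_decodable k {1..n} (Zvec m h) (mv_code m h n g u) (mv_decoder m h g P u))"
proof -
  have g: "has_mult_order g (m1 * m2)" using assms by simp
  obtain P where P: "decoding_polynomial (canonical_set (m1 * m2)) g P"
    and num: "num_monomials P \<le> num_monomials P1 * num_monomials P2"
    using decoding_polynomial_product[OF g \<open>coprime m1 m2\<close> \<open>has_mult_order g1 m1\<close>
      \<open>has_mult_order g2 m2\<close> \<open>decoding_polynomial (canonical_set m1) g1 P1\<close>
      \<open>decoding_polynomial (canonical_set m2) g2 P2\<close>] by blast
  \<comment> \<open>The witness for \<open>k\<close> is \<open>num_monomials P\<close>. The
    polynomial \<open>P\<close> was obtained before \<open>n\<close>, \<open>h\<close> and
    \<open>u\<close> are introduced, so one \<open>P\<close> serves all of them.\<close>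
  show ?thesis
    unfolding \<open>m = m1 * m2\<close>
    using P num mv_code_locally_decodable[OF g P] card_Zvec
      \<open>num_monomials P1 = k1\<close> \<open>num_monomials P2 = k2\<close> by blast
qed

end
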